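(* Every infinite 3-connected cubic graph $G$ has a spanning subgraph that is 2-connected, bipartite, and faithful to $G$.
   Context: A ray is a one-way infinite path; two rays of a graph $H$ are equivalent in $H$ if for every finite $S\subseteq V(H)$ some component of $H-S$ contains tails of both; the equivalence classes are the ends of $H$. A subgraph $F$ of $G$ is faithful to $G$ if (i) every end of $G$ contains a ray of $F$, and (ii) any two rays of $F$ are equivalent in $F$ if and only if they are equivalent in $G$. *)

theory Defs
  imports Main
begin

definition graph :: "'a set \<Rightarrow> 'a set set \<Rightarrow> bool" where
  "graph V E \<longleftrightarrow> (\<forall>e\<in>E. \<exists>u v. u \<noteq> v \<and> u \<in> V \<and> v \<in> V \<and> e = {u, v})"

definition subgraph :: "'a set \<Rightarrow> 'a set set \<Rightarrow> 'a set \<Rightarrow> 'a set set \<Rightarrow> bool" where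
  "subgraph V' E' V E \<longleftrightarrow> graph V' E' \<and> V' \<subseteq> V \<and> E' \<subseteq> E"

definition spanning_subgraph :: "'a set \<Rightarrow> 'a set set \<Rightarrow> 'a set \<Rightarrow> 'a set set \<Rightarrow> bool" where
  "spanning_subgraph V' E' V E \<longleftrightarrow> subgraph V' E' V E \<and> V' = V"

definition cubic :: "'a set \<Rightarrow> 'a set set \<Rightarrow> bool" where
  "cubic V E \<longleftrightarrow> (\<forall>v\<in>V. finite {e\<in>E. v \<in> e} \<and> card {e\<in>E. v \<in> e} = 3)"

definition del_edges :: "'a set set \<Rightarrow> 'a set \<Rightarrow> 'a set set" where
  "del_edges E S = {e\<in>E. e \<inter> S = {}}"

definition reach :: "'a set set \<Rightarrow> 'a \<Rightarrow> 'a \<Rightarrow> bool" where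
  "reach E = (\<lambda>u v. {u, v} \<in> E)\<^sup>*\<^sup>*"

definition connected_graph :: "'a set \<Rightarrow> 'a set set \<Rightarrow> bool" where
  "connected_graph V E \<longleftrightarrow> V \<noteq> {} \<and> (\<forall>u\<in>V. \<forall>v\<in>V. reach E u v)"

definition k_connected :: "nat \<Rightarrow> 'a set \<Rightarrow> 'a set set \<Rightarrow> bool" where
  "k_connected k V E \<longleftrightarrow>
     (infinite V \<or> card V > k) \<and>
     (\<forall>S. S \<subseteq> V \<longrightarrow> finite S \<longrightarrow> card S < k \<longrightarrow> connected_graph (V - S) (del_edges E S))"

definition bipartite :: "'a set \<Rightarrow> 'a set set \<Rightarrow> bool" where
  "bipartite V E \<longleftrightarrow> (\<exists>A B. A \<union> B = V \<and> A \<inter> B = {} \<and>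
      (\<forall>e\<in>E. card (e \<inter> A) = 1 \<and> card (e \<inter> B) = 1))"

definition ray :: "'a set \<Rightarrow> 'a set set \<Rightarrow> (nat \<Rightarrow> 'a) \<Rightarrow> bool" where
  "ray V E r \<longleftrightarrow> inj r \<and> (\<forall>n. r n \<in> V) \<and> (\<forall>n. {r n, r (Suc n)} \<in> E)"

definition components :: "'a set \<Rightarrow> 'a set set \<Rightarrow> 'a set set" where
  "components V E = {{v\<in>V. reach E u v} | u. u \<in> V}"

definition contains_tail :: "'a set \<Rightarrow> (nat \<Rightarrow> 'a) \<Rightarrow> bool" where
  "contains_tail C r \<longleftrightarrow> (\<exists>k. \<forall>n\<ge>k. r n \<in> C)"

definition equiv_rays :: "'a set \<Rightarrow> 'a set set \<Rightarrow> (nat \<Rightarrow> 'a) \<Rightarrow> (nat \<Rightarrow> 'a) \<Rightarrow> bool" where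
  "equiv_rays V E r s \<longleftrightarrow>
     (\<forall>S. S \<subseteq> V \<longrightarrow> finite S \<longrightarrow>
        (\<exists>C\<in>components (V - S) (del_edges E S). contains_tail C r \<and> contains_tail C s))"

definition ends :: "'a set \<Rightarrow> 'a set set \<Rightarrow> (nat \<Rightarrow> 'a) set set" where
  "ends V E = {{s. ray V E s \<and> equiv_rays V E r s} | r. ray V E r}"

definition faithful :: "'a set \<Rightarrow> 'a set set \<Rightarrow> 'a set \<Rightarrow> 'a set set \<Rightarrow> bool" where
  "faithful VF EF V E \<longleftrightarrow> subgraph VF EF V E \<and>
     (\<forall>\<omega>\<in>ends V E. \<exists>r\<in>\<omega>. ray VF EF r) \<and>
     (\<forall>r s. ray VF EF r \<longrightarrow> ray VF EF s \<longrightarrow> (equiv_rays VF EF r s \<longleftrightarrow> equiv_rays V E r s))"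

end

theory Submission
  imports Defs
begin

text \<open>
  Call an edge bichromatic for a vertex set \<open>A\<close> if it has exactly one end in \<open>A\<close>. We look for an \<open>A\<close>
  whose bichromatic edges \<open>F\<close> meet every cut of \<open>G\<close> at least twice, and infinitely often if the cut is
  infinite. The first property makes \<open>F\<close> two-edge-connected, hence two-connected because degrees are at
  most 3; the second makes \<open>F\<close> faithful.

  The set \<open>A\<close> is the limit of colourings of finite sets \<open>T\<close> whose bichromatic edges already have no cut
  of size at most one. To enlarge \<open>T\<close>, split \<open>V - T\<close> into finitely many two-edge-connected regions
  joined to each other and to \<open>T\<close> by finitely many (light) edges. Take finitely many edges that
  witness the three-edge-connectivity of \<open>G\<close> around \<open>T\<close> and the two-edge-connectivity of each region,
  and colour so that first the number of bichromatic edges inside the regions and then that of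
  bichromatic light edges is maximal. Each cut avoiding \<open>T\<close> keeps at least half of its edges, which
  gives at least two of three or more edges, and at least one edge inside every region that is split.
  Hence all regions are connected in \<open>F\<close>, so a cut that is finite in \<open>F\<close> splits no region of a late
  stage and has only light edges there.
\<close>

section \<open>Edge cuts\<close>

text \<open>Serves for cuts and for colourings alike: \<open>ecut E B\<close> is the set of
  bichromatic edges of \<open>B\<close>. A set and its complement have the same cut, and
  \<open>X\<close> may contain points that are not vertices.\<close>

definition ecut :: "'a set set \<Rightarrow> 'a set \<Rightarrow> 'a set set" where
  "ecut J X = {e \<in> J. e \<inter> X \<noteq> {} \<and> e - X \<noteq> {}}"

text \<open>Infinite sets count as large here, whereas \<open>card\<close> gives them the value
  0.\<close>

definition many :: "nat \<Rightarrow> 'a set \<Rightarrow> bool" where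
  "many k S \<longleftrightarrow> (finite S \<longrightarrow> k \<le> card S)"

lemma many_mono: "many k S \<Longrightarrow> S \<subseteq> S' \<Longrightarrow> many k S'"
  unfolding many_def by (meson card_mono finite_subset le_trans)

lemma many_nonempty: "many k S \<Longrightarrow> 0 < k \<Longrightarrow> S \<noteq> {}"
  by (auto simp: many_def)

lemma ecut_mono: "J \<subseteq> J' \<Longrightarrow> ecut J X \<subseteq> ecut J' X"
  by (auto simp: ecut_def)

lemma ecut_subset: "ecut J X \<subseteq> J"
  by (auto simp: ecut_def)

lemma finite_ecut: "finite J \<Longrightarrow> finite (ecut J X)"
  by (simp add: ecut_def)

lemma ecut_cong: "(\<And>v e. e \<in> J \<Longrightarrow> v \<in> e \<Longrightarrow> v \<in> X \<longleftrightarrow> v \<in> Y) \<Longrightarrow> ecut J X = ecut J Y"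
  unfolding ecut_def by blast

lemma pair_in_ecut: "{u, v} \<in> ecut J X \<longleftrightarrow> {u, v} \<in> J \<and> (u \<in> X \<longleftrightarrow> v \<notin> X)"
  by (auto simp: ecut_def)

lemma ecutE:
  assumes "graph V J" "e \<in> ecut J X"
  obtains x y where "e = {x, y}" "x \<in> X" "y \<notin> X" "{x, y} \<in> J" "x \<in> V" "y \<in> V"
proof -
  have "e \<in> J" "e \<inter> X \<noteq> {}" "e - X \<noteq> {}" using assms(2) by (auto simp: ecut_def)
  obtain u v where uv: "u \<in> V" "v \<in> V" "e = {u, v}" using \<open>e \<in> J\<close> assms(1) unfolding graph_def by blast
  have ve: "e = {v, u}" using uv(3) by auto
  show ?thesis
  proof (cases "u \<in> X")
    case True
    then show ?thesis using uv \<open>e - X \<noteq> {}\<close> \<open>e \<in> J\<close> by (intro that[OF uv(3)]) auto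
  next
    case False
    then show ?thesis using uv ve \<open>e \<inter> X \<noteq> {}\<close> \<open>e \<in> J\<close> by (intro that[OF ve]) auto
  qed
qed

section \<open>Reachability in terms of cuts\<close>

lemma reach_refl: "reach J u u"
  by (simp add: reach_def)

lemma reach_step: "reach J u v \<Longrightarrow> {v, w} \<in> J \<Longrightarrow> reach J u w"
  unfolding reach_def by (rule rtranclp.rtrancl_into_rtrancl)

lemma reach_mono: "reach J u v \<Longrightarrow> J \<subseteq> J' \<Longrightarrow> reach J' u v"
  unfolding reach_def by (erule rtranclp_mono[THEN predicate2D, rotated]) blast

lemma reach_trans: "reach J u v \<Longrightarrow> reach J v w \<Longrightarrow> reach J u w"
  unfolding reach_def by (rule rtranclp_trans)

lemma reach_sym: "reach J u v \<Longrightarrow> reach J v u"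
  unfolding reach_def
proof (induction rule: rtranclp_induct)
  case (step y z)
  then show ?case
    by (metis (mono_tags, lifting) converse_rtranclp_into_rtranclp insert_commute)
qed simp

lemma reach_cut:
  assumes "reach J u v" "u \<in> X" "v \<notin> X"
  shows "ecut J X \<noteq> {}"
  using assms(1,3) unfolding reach_def
proof (induction rule: rtranclp_induct)
  case base
  then show ?case using assms(2) by simp
next
  case (step y z)
  show ?case
  proof (cases "y \<in> X")
    case True
    then have "{y, z} \<in> ecut J X" using step by (simp add: pair_in_ecut)
    then show ?thesis by blast
  qed (use step in auto)
qed

text \<open>The set is a union of reachability classes. Together with \<open>reach_cut\<close> this
  translates connectivity into cuts and back.\<close>

lemma cut_reach_empty:
  assumes "graph V J"
  shows "ecut J {v. \<exists>u\<in>D. reach J u v} = {}"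
proof (rule ccontr)
  assume "\<not> ?thesis"
  then obtain e where e: "e \<in> ecut J {v. \<exists>u\<in>D. reach J u v}" by blast
  then have "e \<in> J" by (simp add: ecut_def)
  then obtain x y where xy: "e = {x, y}" using assms by (auto simp: graph_def)
  have "{y, x} \<in> J" "{x, y} \<in> J" using \<open>e \<in> J\<close> xy by (simp_all add: insert_commute)
  then show False using e unfolding xy pair_in_ecut by (auto dest: reach_step)
qed

lemma reach_finite:
  assumes "reach J u v"
  shows "\<exists>K\<subseteq>J. finite K \<and> reach K u v"
  using assms unfolding reach_def
proof (induction rule: rtranclp_induct)
  case base
  then show ?case by (intro exI[of _ "{}"]) auto
next
  case (step y z)
  then obtain K where K: "K \<subseteq> J" "finite K" "reach K u y" by (auto simp: reach_def)
  have "reach (insert {y, z} K) u z"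
    using K(3) by (meson insertI1 reach_mono reach_step subset_insertI)
  then show ?case using K step by (intro exI[of _ "insert {y, z} K"]) (auto simp: reach_def)
qed

section \<open>Finite witnesses for cut conditions\<close>

text \<open>The finite set \<open>U\<close> has finitely many traces \<open>D\<close>. The vertices
  reachable from \<open>D\<close> have an empty cut, so their trace is larger than \<open>D\<close>
  and a finite path runs from \<open>D\<close> to \<open>U - D\<close>. This path crosses every
  \<open>X\<close> with trace \<open>D\<close>.\<close>

lemma finite_subset_cut_nonempty:
  assumes "graph V J" "finite U"
    and ne: "\<And>X. X \<inter> U \<in> \<D> \<Longrightarrow> ecut J X \<noteq> {}"
  shows "\<exists>K\<subseteq>J. finite K \<and> (\<forall>X. X \<inter> U \<in> \<D> \<longrightarrow> ecut K X \<noteq> {})"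
proof -
  have "\<exists>K\<subseteq>J. finite K \<and> (\<forall>X. X \<inter> U = D \<longrightarrow> ecut K X \<noteq> {})"
    if D: "D \<in> \<D>" "D \<subseteq> U" for D
  proof -
    let ?X = "{v. \<exists>u\<in>D. reach J u v}"
    have "D \<subseteq> ?X" by (auto intro: reach_refl)
    moreover have "?X \<inter> U \<noteq> D"
      using ne[of ?X] cut_reach_empty[OF assms(1)] D by metis
    ultimately obtain d u where du: "d \<in> D" "u \<in> U - D" "reach J d u" using D by blast
    then obtain K where "K \<subseteq> J" "finite K" "reach K d u" using reach_finite by metis
    with du show ?thesis by (intro exI[of _ K]) (auto dest: reach_cut)
  qed
  then obtain K where K: "\<And>D. D \<in> \<D> \<Longrightarrow> D \<subseteq> U \<Longrightarrow>
      K D \<subseteq> J \<and> finite (K D) \<and> (\<forall>X. X \<inter> U = D \<longrightarrow> ecut (K D) X \<noteq> {})" by metis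
  let ?K = "\<Union>D\<in>\<D> \<inter> Pow U. K D"
  have "ecut ?K X \<noteq> {}" if "X \<inter> U \<in> \<D>" for X
    using K[OF that] that ecut_mono[of "K (X \<inter> U)" ?K X] by fastforce
  moreover have "?K \<subseteq> J" using K by blast
  moreover have "finite ?K" using K assms(2) by (intro finite_UN_I) auto
  ultimately show ?thesis by blast
qed

text \<open>A substitute for compactness (or Menger's theorem): once \<open>k\<close> crossing edges are found in a finite
  set, one more is found by deleting each \<open>k\<close>-subset of it in turn.\<close>

lemma finite_subset_cut_many:
  assumes "graph V J" "finite U"
    and "\<And>X. X \<inter> U \<in> \<D> \<Longrightarrow> many k (ecut J X)"
  shows "\<exists>K\<subseteq>J. finite K \<and> (\<forall>X. X \<inter> U \<in> \<D> \<longrightarrow> k \<le> card (ecut K X))"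
  using assms(3)
proof (induction k)
  case 0
  then show ?case by auto
next
  case (Suc k)
  have "many k (ecut J X)" if "X \<inter> U \<in> \<D>" for X
    using Suc(2)[OF that] by (auto simp: many_def)
  then obtain K where K: "K \<subseteq> J" "finite K" "\<And>X. X \<inter> U \<in> \<D> \<Longrightarrow> k \<le> card (ecut K X)"
    using Suc by blast
  have "\<exists>L\<subseteq>J - S. finite L \<and> (\<forall>X. X \<inter> U \<in> \<D> \<longrightarrow> ecut L X \<noteq> {})"
    if S: "S \<subseteq> K" "card S = k" for S
  proof (rule finite_subset_cut_nonempty)
    show "graph V (J - S)" using assms(1) by (auto simp: graph_def)
    show "ecut (J - S) X \<noteq> {}" if "X \<inter> U \<in> \<D>" for X
    proof
      assume "ecut (J - S) X = {}"
      then have sub: "ecut J X \<subseteq> S" by (auto simp: ecut_def)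
      have "finite S" using S K finite_subset by blast
      then show False
        using Suc(2)[OF that] S sub card_mono[OF _ sub] finite_subset[OF sub]
        by (auto simp: many_def)
    qed
  qed (use assms in auto)
  then obtain L where L: "\<And>S. S \<subseteq> K \<Longrightarrow> card S = k \<Longrightarrow>
     L S \<subseteq> J - S \<and> finite (L S) \<and> (\<forall>X. X \<inter> U \<in> \<D> \<longrightarrow> ecut (L S) X \<noteq> {})" by metis
  let ?L = "K \<union> (\<Union>S\<in>{S \<in> Pow K. card S = k}. L S)"
  have fin: "finite ?L" using K L by (intro finite_UnI finite_UN_I) auto
  have "Suc k \<le> card (ecut ?L X)" if X: "X \<inter> U \<in> \<D>" for X
  proof (cases "card (ecut K X) = k")
    case False
    then have "Suc k \<le> card (ecut K X)" using K(3)[OF X] by simp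
    also have "\<dots> \<le> card (ecut ?L X)" by (intro card_mono finite_ecut ecut_mono fin) auto
    finally show ?thesis .
  next
    case True
    \<comment> \<open>The deleted set is exactly the set of known crossing edges, so the edge
      supplied by \<open>L ?S\<close> is a new one.\<close>
    let ?S = "ecut K X"
    have LS: "L ?S \<subseteq> J - ?S" "ecut (L ?S) X \<noteq> {}"
      using L[of ?S] True X ecut_subset[of K X] by auto
    then obtain e where e: "e \<in> ecut (L ?S) X" "e \<notin> ?S" using ecut_subset[of "L ?S" X] by blast
    have "?S \<in> {S \<in> Pow K. card S = k}" using True ecut_subset[of K X] by simp
    then have "L ?S \<subseteq> ?L" by (intro le_supI2 UN_upper)
    then have "insert e ?S \<subseteq> ecut ?L X" using e(1) by (auto simp: ecut_def)
    then have "card (insert e ?S) \<le> card (ecut ?L X)" using fin by (intro card_mono finite_ecut)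
    then show ?thesis using e True finite_ecut[OF K(2)] by simp
  qed
  moreover have "?L \<subseteq> J" using K L by blast
  ultimately show ?case using fin by blast
qed

section \<open>Maximum cuts and pruning\<close>

text \<open>An edge crosses the symmetric difference iff it crosses exactly one of the two sets. For
  a colouring \<open>A\<close>, passing to the symmetric difference means flipping the colours on
  \<open>X\<close>.\<close>

lemma card_cut_sym_diff:
  assumes "graph V J" "finite J"
  shows "card (ecut J (A - X \<union> (X - A))) + 2 * card (ecut J X \<inter> ecut J A)
         = card (ecut J A) + card (ecut J X)"
proof -
  let ?P = "ecut J A" and ?Q = "ecut J X"
  have "e \<in> ecut J (A - X \<union> (X - A)) \<longleftrightarrow> e \<in> (?P - ?Q) \<union> (?Q - ?P)" for e
  proof (cases "e \<in> J")
    case True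
    then obtain u v where "e = {u, v}" using assms by (auto simp: graph_def)
    then show ?thesis using True by (auto simp: ecut_def)
  qed (auto simp: ecut_def)
  then have eq: "ecut J (A - X \<union> (X - A)) = (?P - ?Q) \<union> (?Q - ?P)" by blast
  have fin: "finite ?P" "finite ?Q" using assms finite_ecut by auto
  have "card ((?P - ?Q) \<union> (?Q - ?P)) = card (?P - ?Q) + card (?Q - ?P)"
    using fin by (intro card_Un_disjoint) auto
  moreover have "card ?P = card (?P - ?Q) + card (?Q \<inter> ?P)"
    using fin by (metis Int_commute card_Int_Diff add.commute)
  moreover have "card ?Q = card (?Q - ?P) + card (?Q \<inter> ?P)"
    using fin by (metis card_Int_Diff add.commute)
  ultimately show ?thesis unfolding eq by simp
qed

text \<open>A lexicographic maximum cut, encoded by giving every edge of \<open>H\<close> more weight than all of \<open>L\<close>.\<close>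

lemma lexicographic_max_cut:
  assumes "graph V H" "graph V L" "finite H" "finite L"
  obtains A where "A \<inter> T = A0 \<inter> T"
    and "\<And>X. X \<inter> T = {} \<Longrightarrow> card (ecut H X) \<le> 2 * card (ecut H X \<inter> ecut H A)"
    and "\<And>X. X \<inter> T = {} \<Longrightarrow> card (ecut H X) = 2 * card (ecut H X \<inter> ecut H A) \<Longrightarrow>
           card (ecut L X) \<le> 2 * card (ecut L X \<inter> ecut L A)"
proof -
  define B where "B = Suc (card L)"
  define w where "w A = B * card (ecut H A) + card (ecut L A)" for A
  have "w A \<le> B * card H + card L" for A
    unfolding w_def using assms by (intro add_mono mult_le_mono2 card_mono ecut_subset)
  then have "\<forall>A. A \<inter> T = A0 \<inter> T \<longrightarrow> w A < Suc (B * card H + card L)" by (simp add: less_Suc_eq_le)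
  from ex_has_greatest_nat[of "\<lambda>A. A \<inter> T = A0 \<inter> T" A0 w, OF _ this]
  obtain A where A: "A \<inter> T = A0 \<inter> T" "\<And>A'. A' \<inter> T = A0 \<inter> T \<Longrightarrow> w A' \<le> w A" by blast
  have key: "card (ecut H X) \<le> 2 * card (ecut H X \<inter> ecut H A) \<and>
     (card (ecut H X) = 2 * card (ecut H X \<inter> ecut H A) \<longrightarrow>
           card (ecut L X) \<le> 2 * card (ecut L X \<inter> ecut L A))" if X: "X \<inter> T = {}" for X
  proof -
    \<comment> \<open>Flipping \<open>X\<close> changes nothing on \<open>T\<close>, so
      \<open>?D\<close> competes with the maximum \<open>A\<close>.\<close>
    let ?D = "A - X \<union> (X - A)"
    define h fh l fl where "h = card (ecut H X)" and "fh = card (ecut H X \<inter> ecut H A)"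
      and "l = card (ecut L X)" and "fl = card (ecut L X \<inter> ecut L A)"
    have "?D \<inter> T = A0 \<inter> T" using X A(1) by blast
    then have le: "w ?D \<le> w A" using A(2) by blast
    have cH: "card (ecut H ?D) + 2 * fh = card (ecut H A) + h"
      and cL: "card (ecut L ?D) + 2 * fl = card (ecut L A) + l"
      unfolding h_def fh_def l_def fl_def using assms by (auto intro: card_cut_sym_diff)
    have "B * card (ecut H ?D) + B * (2 * fh) = B * card (ecut H A) + B * h"
      using cH by (metis distrib_left)
    then have main: "B * h + l \<le> B * (2 * fh) + 2 * fl" using le cL unfolding w_def by linarith
    have "fl \<le> l" "l \<le> card L" unfolding l_def fl_def using assms
      by (auto intro!: card_mono finite_ecut ecut_subset)
    have "h \<le> 2 * fh"
    proof (rule ccontr)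
      assume "\<not> h \<le> 2 * fh"
      \<comment> \<open>Flipping would gain at least \<open>B\<close> from \<open>H\<close> and lose
        at most \<open>2 * fl - l \<le> card L < B\<close> from \<open>L\<close>.\<close>
      then have "B * (2 * fh + 1) \<le> B * h" by (intro mult_le_mono2) simp
      then show False using main \<open>fl \<le> l\<close> \<open>l \<le> card L\<close> by (simp add: B_def)
    qed
    moreover have "l \<le> 2 * fl" if "h = 2 * fh" using main that by simp
    ultimately show ?thesis unfolding h_def fh_def l_def fl_def by blast
  qed
  show ?thesis by (rule that[OF A(1)]) (use key in auto)
qed


text \<open>A set \<open>X\<close> outside \<open>B\<close> with at most one edge leaving it can be discarded: a cut of what remains
  extends to \<open>X\<close> without cutting that edge.\<close>

lemma prune:
  assumes "graph V K" "finite W" "B \<subseteq> W"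
  obtains T' where "B \<subseteq> T'" "T' \<subseteq> W"
    and "\<And>Y. \<exists>Y'. Y' \<inter> B = Y \<inter> B \<and> ecut {e \<in> K. e \<subseteq> W} Y' = ecut {e \<in> K. e \<subseteq> T'} Y"
    and "\<And>X. X \<inter> B = {} \<Longrightarrow> X \<inter> T' \<noteq> {} \<Longrightarrow> many 2 (ecut {e \<in> K. e \<subseteq> T'} X)"
proof -
  define R where "R T = {e \<in> K. e \<subseteq> T}" for T
  define P where "P T \<longleftrightarrow> B \<subseteq> T \<and> T \<subseteq> W \<and>
    (\<forall>Y. \<exists>Y'. Y' \<inter> B = Y \<inter> B \<and> ecut (R W) Y' = ecut (R T) Y)" for T
  have "P W" using assms(3) by (auto simp: P_def)
  \<comment> \<open>A smallest \<open>T\<close> will do: a set \<open>X\<close> violating the last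
    claim could be removed, and \<open>T - X\<close> would be smaller.\<close>
  then obtain T where T: "P T" and min: "\<And>T'. P T' \<Longrightarrow> card T \<le> card T'"
    using arg_min_nat_lemma[of P W card] by blast
  have finT: "finite T" using T assms(2) finite_subset by (auto simp: P_def)
  have "many 2 (ecut (R T) X)" if X: "X \<inter> B = {}" "X \<inter> T \<noteq> {}" for X
  proof (rule ccontr)
    assume "\<not> ?thesis"
    then have few: "finite (ecut (R T) X)" "card (ecut (R T) X) \<le> Suc 0" by (auto simp: many_def)
    have one: "e = e'" if "e \<in> ecut (R T) X" "e' \<in> ecut (R T) X" for e e'
      using few that card_le_Suc0_iff_eq[OF few(1)] by blast
    have "\<exists>Y'. Y' \<inter> B = Y \<inter> B \<and> ecut (R T) Y' = ecut (R (T - X)) Y" for Y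
    proof -
      \<comment> \<open>\<open>b\<close> tells whether the outer end of the only crossing edge lies
        in \<open>Y\<close>; without such an edge any value is right. Placing all of
        \<open>X\<close> on that side leaves the edge uncut.\<close>
      obtain b where b: "\<And>x z. {x, z} \<in> ecut (R T) X \<Longrightarrow> x \<in> X \<Longrightarrow> z \<in> Y \<longleftrightarrow> b"
      proof (cases "\<exists>x z. {x, z} \<in> ecut (R T) X \<and> x \<in> X")
        case True
        then obtain x z where xz: "{x, z} \<in> ecut (R T) X" "x \<in> X" by blast
        show ?thesis
        proof (rule that[of "z \<in> Y"])
          fix x' z' assume "{x', z'} \<in> ecut (R T) X" "x' \<in> X"
          then show "z' \<in> Y \<longleftrightarrow> z \<in> Y"
            using xz one[of "{x', z'}" "{x, z}"] by (auto simp: pair_in_ecut doubleton_eq_iff)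
        qed
      qed blast
      let ?Y = "(Y - X) \<union> (if b then X else {})"
      have "e \<in> ecut (R T) ?Y \<longleftrightarrow> e \<in> ecut (R (T - X)) Y" for e
      proof (cases "e \<in> R T")
        case False
        then show ?thesis by (auto simp: ecut_def R_def)
      next
        case True
        then obtain x z where xz: "e = {x, z}" using assms(1) by (auto simp: graph_def R_def)
        have "z \<in> Y \<longleftrightarrow> b" if "x \<in> X" "z \<notin> X" using b[of x z] True that
          unfolding xz pair_in_ecut by blast
        moreover have "x \<in> Y \<longleftrightarrow> b" if "z \<in> X" "x \<notin> X" using b[of z x] True that
          unfolding xz by (simp add: pair_in_ecut insert_commute)
        ultimately show ?thesis using True unfolding xz pair_in_ecut by (auto simp: R_def)
      qed
      then have "ecut (R T) ?Y = ecut (R (T - X)) Y" by blast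
      moreover have "?Y \<inter> B = Y \<inter> B" using X by auto
      ultimately show ?thesis by blast
    qed
    then have "P (T - X)" using T X(1) unfolding P_def by (metis Diff_subset Int_commute le_iff_inf
      subset_trans Int_Diff Diff_Int_distrib2 Diff_triv)
    then have "card T \<le> card (T - X)" by (rule min)
    moreover have "T - X \<subset> T" using X by blast
    then have "card (T - X) < card T" by (rule psubset_card_mono[OF finT])
    ultimately show False by linarith
  qed
  then show ?thesis using T unfolding P_def R_def by (intro that[of T]) auto
qed

text \<open>Restricted to edges inside \<open>T\<close> because later stages keep the colours on
  \<open>T\<close>: these edges stay bichromatic forever.\<close>

definition bichromatic :: "'a set set \<Rightarrow> 'a set \<Rightarrow> 'a set \<Rightarrow> 'a set set" where
  "bichromatic E T A = {e \<in> ecut E A. e \<subseteq> T}"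


section \<open>Growing a coloured finite set\<close>

locale three_edge_connected =
  fixes V :: "'a set" and E :: "'a set set"
  assumes graph: "graph V E" and infinite: "infinite V"
    and locally_finite: "\<And>v. finite {e \<in> E. v \<in> e}"
    and three_cut: "\<And>X. X \<inter> V \<noteq> {} \<Longrightarrow> V - X \<noteq> {} \<Longrightarrow> many 3 (ecut E X)"
begin

lemma edgeE:
  assumes "e \<in> E"
  obtains u v where "u \<noteq> v" "u \<in> V" "v \<in> V" "e = {u, v}"
  using graph assms by (auto simp: graph_def)

lemma edge_subset: "e \<in> E \<Longrightarrow> e \<subseteq> V"
  by (auto elim: edgeE)

lemma graph_edges: "J \<subseteq> E \<Longrightarrow> graph V J"
  using graph by (auto simp: graph_def)

lemma finite_edges_meeting: "finite T \<Longrightarrow> finite {e \<in> E. e \<inter> T \<noteq> {}}"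
proof -
  assume "finite T"
  then have "finite (\<Union>v\<in>T. {e \<in> E. v \<in> e})" using locally_finite by blast
  then show ?thesis by (rule finite_subset[rotated]) auto
qed

lemma finite_Union_edges: "J \<subseteq> E \<Longrightarrow> finite J \<Longrightarrow> finite (\<Union>J)"
  by (rule finite_Union) (auto elim: edgeE)

section \<open>Partitions of the complement of a finite set\<close>

definition region :: "'a set \<Rightarrow> ('a \<Rightarrow> nat) \<Rightarrow> nat \<Rightarrow> 'a set" where
  "region T c i = {v \<in> V - T. c v = i}"

definition inner :: "'a set \<Rightarrow> ('a \<Rightarrow> nat) \<Rightarrow> nat \<Rightarrow> 'a set set" where
  "inner T c i = {e \<in> E. e \<subseteq> region T c i}"

text \<open>Besides the edges between different classes, these include all edges with an end in
  \<open>T\<close>, since no region meets \<open>T\<close>.\<close>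

definition light :: "'a set \<Rightarrow> ('a \<Rightarrow> nat) \<Rightarrow> 'a set set" where
  "light T c = {e \<in> E. \<forall>i. \<not> e \<subseteq> region T c i}"

text \<open>The only vertices of a region with edges leaving it. They are finitely many once
  \<open>light T c\<close> is finite, so splitting a region is tested on them.\<close>

definition attach :: "'a set \<Rightarrow> ('a \<Rightarrow> nat) \<Rightarrow> nat \<Rightarrow> 'a set" where
  "attach T c i = region T c i \<inter> \<Union>(light T c)"

text \<open>A partition of \<open>V - T\<close> with as many classes as possible, subject to having fewer
  edges between classes than classes: since every class sends out three edges, the number of classes is
  bounded, and a class with a cut of size at most one could be split further.\<close>

lemma two_connected_regions:
  assumes T: "finite T" "T \<subseteq> V" "T \<noteq> {}"
  obtains c where "finite (light T c)"
    and "\<And>i X. region T c i \<inter> X \<noteq> {} \<Longrightarrow> region T c i - X \<noteq> {} \<Longrightarrow> many 2 (ecut (inner T c i) X)"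
proof -
  define L where "L c = {e \<in> light T c. e \<inter> T = {}}" for c
  \<comment> \<open>The strict inequality survives splitting a class along a cut of at most one
    edge: \<open>p\<close> grows by one and \<open>card (L c)\<close> by at most one.\<close>
  define good where "good p c \<longleftrightarrow> c ` (V - T) = {..<p} \<and> finite (L c) \<and> card (L c) < p" for p c
  have finT: "finite (ecut E T)"
    using finite_edges_meeting[OF T(1)] by (rule finite_subset[rotated]) (auto simp: ecut_def)
  have "V - T \<noteq> {}" using infinite T(1) by (metis Diff_eq_empty_iff finite_subset)
  have "L (\<lambda>_. 0) = {}" unfolding L_def light_def region_def using edge_subset by fastforce
  then have good1: "good 1 (\<lambda>_. 0)" using \<open>V - T \<noteq> {}\<close> by (auto simp: good_def)
  have bound: "p \<le> card (ecut E T)" if "good p c" for p c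
  proof -
    have c: "c ` (V - T) = {..<p}" "finite (L c)" "card (L c) < p" using that by (auto simp: good_def)
    let ?S = "L c \<union> ecut E T"
    have sub: "ecut E (region T c i) \<subseteq> ?S" for i
    proof
      fix e assume e: "e \<in> ecut E (region T c i)"
      then have "e \<in> E" by (simp add: ecut_def)
      then obtain u v where uv: "u \<in> V" "v \<in> V" "e = {u, v}" by (rule edgeE)
      show "e \<in> ?S" using e \<open>e \<in> E\<close> uv
        unfolding uv(3) Un_iff pair_in_ecut L_def light_def region_def by auto
    qed
    have fin: "finite ?S" using c finT by simp
    have ge3: "3 \<le> card (ecut E (region T c i))" if "i < p" for i
    proof -
      have "i \<in> c ` (V - T)" using that by (simp add: c(1))
      then obtain v where "v \<in> V - T" "c v = i" by auto
      then have "region T c i \<inter> V \<noteq> {}" by (auto simp: region_def)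
      moreover have "V - region T c i \<noteq> {}" using T by (auto simp: region_def)
      ultimately have "many 3 (ecut E (region T c i))" by (rule three_cut)
      then show ?thesis using finite_subset[OF sub fin] by (auto simp: many_def)
    qed
    have two: "card {i \<in> {..<p}. e \<in> ecut E (region T c i)} \<le> (if e \<in> ecut E T then 1 else 2)"
      if "e \<in> ?S" for e
    proof -
      have "e \<in> E" using that by (auto simp: L_def light_def ecut_def)
      then obtain u v where uv: "u \<in> V" "v \<in> V" "e = {u, v}" by (rule edgeE)
      show ?thesis
      proof (cases "e \<in> ecut E T")
        case False
        have "{i \<in> {..<p}. e \<in> ecut E (region T c i)} \<subseteq> {c u, c v}"
          unfolding uv(3) pair_in_ecut by (auto simp: region_def)
        then have "card {i \<in> {..<p}. e \<in> ecut E (region T c i)} \<le> card {c u, c v}"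
          by (intro card_mono) auto
        also have "\<dots> \<le> 2" by (simp add: card_insert_if)
        finally show ?thesis using False by simp
      next
        case True
        then have "{i \<in> {..<p}. e \<in> ecut E (region T c i)} \<subseteq> {if u \<in> T then c v else c u}"
          unfolding uv(3) pair_in_ecut by (auto simp: region_def)
        then have "card {i \<in> {..<p}. e \<in> ecut E (region T c i)} \<le> card {if u \<in> T then c v else c u}"
          by (intro card_mono) auto
        then show ?thesis using True by simp
      qed
    qed
    \<comment> \<open>Double counting of pairs of a class and an edge leaving it: an edge at
      \<open>T\<close> leaves at most one class, an edge between classes at most two. Then
      \<open>card (L c) < p\<close> absorbs \<open>2 * p\<close>.\<close>
    have "3 * p \<le> (\<Sum>i<p. card (ecut E (region T c i)))"
      using sum_mono[of "{..<p}" "\<lambda>_. 3" "\<lambda>i. card (ecut E (region T c i))"] ge3 by simp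
    also have "\<dots> = (\<Sum>i<p. \<Sum>e\<in>?S. if e \<in> ecut E (region T c i) then 1 else 0)"
      using sub fin by (intro sum.cong refl) (simp add: sum.If_cases Int_absorb1)
    also have "\<dots> = (\<Sum>e\<in>?S. \<Sum>i<p. if e \<in> ecut E (region T c i) then 1 else 0)" by (rule sum.swap)
    also have "\<dots> = (\<Sum>e\<in>?S. card {i \<in> {..<p}. e \<in> ecut E (region T c i)})"
      by (intro sum.cong refl) (simp add: sum.If_cases Int_def)
    also have "\<dots> \<le> (\<Sum>e\<in>?S. if e \<in> ecut E T then 1 else 2)" using two by (intro sum_mono) auto
    also have "\<dots> = (\<Sum>e\<in>L c. if e \<in> ecut E T then 1 else 2) + (\<Sum>e\<in>ecut E T. 1)"
      using c finT by (subst sum.union_disjoint) (auto simp: L_def ecut_def)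
    also have "(\<Sum>e\<in>L c. if e \<in> ecut E T then 1 else 2) = (\<Sum>e\<in>L c. 2)"
      by (rule sum.cong) (auto simp: L_def ecut_def)
    finally have "3 * p \<le> 2 * card (L c) + card (ecut E T)" by simp
    then show ?thesis using c(3) by simp
  qed
  have "\<forall>p. (\<exists>c. good p c) \<longrightarrow> p < Suc (card (ecut E T))" using bound by (auto simp: less_Suc_eq_le)
  from ex_has_greatest_nat[of "\<lambda>p. \<exists>c. good p c" 1 "\<lambda>p. p", OF _ this]
  obtain p c where pc: "good p c" and max: "\<And>p' c'. good p' c' \<Longrightarrow> p' \<le> p" using good1 by blast
  show ?thesis
  proof (rule that)
    have "light T c \<subseteq> {e \<in> E. e \<inter> T \<noteq> {}} \<union> L c" by (auto simp: L_def light_def)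
    then show "finite (light T c)"
      using finite_edges_meeting[OF T(1)] pc by (auto simp: good_def intro: finite_subset)
    fix i X
    assume X: "region T c i \<inter> X \<noteq> {}" "region T c i - X \<noteq> {}"
    show "many 2 (ecut (inner T c i) X)"
    proof (rule ccontr)
      assume "\<not> ?thesis"
      then have few: "finite (ecut (inner T c i) X)" "card (ecut (inner T c i) X) \<le> 1"
        by (auto simp: many_def)
      \<comment> \<open>The part of class \<open>i\<close> inside \<open>X\<close> becomes a class
        of its own; its label \<open>p\<close> is new since the labels on \<open>V - T\<close> are
        those below \<open>p\<close>.\<close>
      define c' where "c' v = (if v \<in> region T c i \<inter> X then p else c v)" for v
      have img: "c ` (V - T) = {..<p}" using pc by (simp add: good_def)
      have "c' ` (V - T) = {..<Suc p}"
      proof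
        show "c' ` (V - T) \<subseteq> {..<Suc p}"
        proof
          fix y assume "y \<in> c' ` (V - T)"
          then obtain v where "v \<in> V - T" "y = c' v" by blast
          moreover have "c v < p" using img \<open>v \<in> V - T\<close> by blast
          ultimately show "y \<in> {..<Suc p}" by (simp add: c'_def)
        qed
        show "{..<Suc p} \<subseteq> c' ` (V - T)"
        proof
          fix y assume "y \<in> {..<Suc p}"
          then consider "y = p" | "y < p" "y = i" | "y < p" "y \<noteq> i" by force
          then show "y \<in> c' ` (V - T)"
          proof cases
            case 1
            obtain v where "v \<in> region T c i \<inter> X" using X by blast
            then show ?thesis using 1 by (auto simp: c'_def region_def image_iff intro!: bexI[of _ v])
          next
            case 2
            obtain v where "v \<in> region T c i - X" using X by blast
            then show ?thesis using 2 by (auto simp: c'_def region_def image_iff intro!: bexI[of _ v])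
          next
            case 3
            then have "y \<in> c ` (V - T)" by (simp add: img)
            then obtain v where "v \<in> V - T" "c v = y" by auto
            then show ?thesis using 3 by (auto simp: c'_def region_def image_iff intro!: bexI[of _ v])
          qed
        qed
      qed
      moreover have sub: "L c' \<subseteq> L c \<union> ecut (inner T c i) X"
      proof
        fix e assume e: "e \<in> L c'"
        then have eE: "e \<in> E" "e \<inter> T = {}" by (auto simp: L_def light_def)
        then obtain u v where uv: "u \<in> V" "v \<in> V" "e = {u, v}" by (meson edgeE)
        have ne: "c' u \<noteq> c' v"
        proof
          assume "c' u = c' v"
          then have "e \<subseteq> region T c' (c' u)" using eE uv by (auto simp: region_def)
          then show False using e by (auto simp: L_def light_def)
        qed
        show "e \<in> L c \<union> ecut (inner T c i) X"
        proof (rule ccontr)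
          assume not: "e \<notin> L c \<union> ecut (inner T c i) X"
          then obtain j where j: "e \<subseteq> region T c j" using eE by (auto simp: L_def light_def)
          then have "c u = j" "c v = j" using uv by (auto simp: region_def)
          then have "j = i" "u \<in> X \<longleftrightarrow> v \<notin> X" using ne eE uv by (auto simp: c'_def region_def split: if_splits)
          then have "e \<in> ecut (inner T c i) X" using j eE unfolding uv(3) pair_in_ecut inner_def by simp
          then show False using not by blast
        qed
      qed
      moreover have fin': "finite (L c \<union> ecut (inner T c i) X)" using few pc by (simp add: good_def)
      moreover have "card (L c') < Suc p"
      proof -
        have "card (L c') \<le> card (L c \<union> ecut (inner T c i) X)" using sub fin' by (rule card_mono[rotated])
        also have "\<dots> \<le> card (L c) + card (ecut (inner T c i) X)" by (rule card_Un_le)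
        finally show ?thesis using few pc by (simp add: good_def)
      qed
      ultimately have "good (Suc p) c'" unfolding good_def by (blast intro: finite_subset)
      then show False using max by fastforce
    qed
  qed
qed

section \<open>One stage of the construction and its iteration\<close>

text \<open>Two-edge-connectivity of the bichromatic graph on \<open>T\<close>. It is vacuous for a
  single vertex, which is where the construction starts.\<close>

definition two_cut :: "'a set \<Rightarrow> 'a set \<Rightarrow> bool" where
  "two_cut T A \<longleftrightarrow> (\<forall>X. X \<inter> T \<noteq> {} \<longrightarrow> T - X \<noteq> {} \<longrightarrow> many 2 (ecut (bichromatic E T A) X))"

text \<open>Maximal colouring followed by pruning. \<open>two_cut\<close> is the invariant,
  absorbing all light edges makes the stages exhaust \<open>V\<close>, and the last property lets
  the limit argument exclude split regions.\<close>

lemma grow: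
  assumes T: "finite T" "T \<subseteq> V" "T \<noteq> {}" and tc: "two_cut T A"
  obtains T' A' c where "finite T'" "T' \<subseteq> V" "T \<subseteq> T'" "\<Union>(light T c) \<subseteq> T'" "A' \<inter> T = A \<inter> T"
    "two_cut T' A'" "finite (light T c)"
    "\<And>i X. attach T c i \<inter> X \<noteq> {} \<Longrightarrow> attach T c i - X \<noteq> {} \<Longrightarrow>
       ecut (bichromatic E T' A' \<inter> inner T c i) X \<noteq> {}"
proof -
  obtain c where light: "finite (light T c)"
    and reg: "\<And>i X. region T c i \<inter> X \<noteq> {} \<Longrightarrow> region T c i - X \<noteq> {} \<Longrightarrow>
       many 2 (ecut (inner T c i) X)"
    using two_connected_regions[OF T] by blast
  define U L where "U = \<Union>(light T c)" and "L = light T c"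
  have LE: "L \<subseteq> E" by (auto simp: L_def light_def)
  have finL: "finite L" using light by (simp add: L_def)
  have finU: "finite U" unfolding U_def using light LE finite_Union_edges by (simp add: L_def)
  have UV: "U \<subseteq> V" using LE edge_subset by (auto simp: U_def L_def)
  have att: "attach T c i \<subseteq> U" "attach T c i \<subseteq> region T c i" for i by (auto simp: attach_def U_def)
  \<comment> \<open>Whether \<open>X\<close> avoids \<open>T\<close> and meets \<open>U\<close>
    depends only on its trace on the finite set \<open>T \<union> U\<close>, so finitely many edges
    witness \<open>three_cut\<close> for all such \<open>X\<close>. The \<open>K i\<close> below do
    the same for the regions.\<close>
  have "\<exists>J\<subseteq>E. finite J \<and> (\<forall>X. X \<inter> (T \<union> U) \<in> {D. D \<inter> T = {} \<and> D \<noteq> {}} \<longrightarrow> 3 \<le> card (ecut J X))"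
  proof (rule finite_subset_cut_many[OF graph])
    show "finite (T \<union> U)" using T finU by simp
    show "many 3 (ecut E X)" if "X \<inter> (T \<union> U) \<in> {D. D \<inter> T = {} \<and> D \<noteq> {}}" for X
      using that T UV by (intro three_cut) auto
  qed
  then obtain J where J: "J \<subseteq> E" "finite J"
    and J0: "\<And>X. X \<inter> (T \<union> U) \<in> {D. D \<inter> T = {} \<and> D \<noteq> {}} \<Longrightarrow> 3 \<le> card (ecut J X)"
    by blast
  have J3: "3 \<le> card (ecut J X)" if "X \<inter> T = {}" "X \<inter> U \<noteq> {}" for X
    using that by (intro J0) auto
  have "\<exists>K\<subseteq>inner T c i. finite K \<and>
      (\<forall>X. X \<inter> attach T c i \<in> {D. D \<noteq> {} \<and> D \<noteq> attach T c i} \<longrightarrow> 2 \<le> card (ecut K X))" for i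
  proof (rule finite_subset_cut_many)
    show "graph V (inner T c i)" by (rule graph_edges) (auto simp: inner_def)
    show "finite (attach T c i)" using att(1) finU finite_subset by blast
    show "many 2 (ecut (inner T c i) X)"
      if "X \<inter> attach T c i \<in> {D. D \<noteq> {} \<and> D \<noteq> attach T c i}" for X
      using that att(2)[of i] by (intro reg) auto
  qed
  then obtain K where K0: "\<And>i. K i \<subseteq> inner T c i \<and> finite (K i) \<and>
      (\<forall>X. X \<inter> attach T c i \<in> {D. D \<noteq> {} \<and> D \<noteq> attach T c i} \<longrightarrow> 2 \<le> card (ecut (K i) X))"
    by metis
  then have K: "\<And>i. K i \<subseteq> inner T c i" "\<And>i. finite (K i)" by auto
  have K2: "2 \<le> card (ecut (K i) X)" if "X \<inter> attach T c i \<noteq> {}" "attach T c i - X \<noteq> {}" for i X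
    using that K0[of i] by blast
  \<comment> \<open>The labels occurring on \<open>U\<close> cover every region with an attachment
    vertex, so finitely many \<open>K i\<close> suffice. Without \<open>L\<close>, all edges of
    \<open>H\<close> lie inside regions and are counted apart from the light ones.\<close>
  define H where "H = (\<Union>i\<in>c ` U. K i) \<union> (J - L)"
  have HE: "H \<subseteq> E" using J K by (auto simp: H_def inner_def)
  have finH: "finite H" using J K finU by (auto simp: H_def)
  have Hin: "\<exists>i. e \<subseteq> region T c i" if "e \<in> H" for e
    using that K J by (auto simp: H_def inner_def L_def light_def)
  have HL: "H \<inter> L = {}" using Hin by (auto simp: L_def light_def)
  have HT: "e \<inter> T = {}" if "e \<in> H" for e using Hin[OF that] by (auto simp: region_def)
  obtain A' where A'T: "A' \<inter> T = A \<inter> T"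
    and h: "\<And>X. X \<inter> T = {} \<Longrightarrow> card (ecut H X) \<le> 2 * card (ecut H X \<inter> ecut H A')"
    and l: "\<And>X. X \<inter> T = {} \<Longrightarrow> card (ecut H X) = 2 * card (ecut H X \<inter> ecut H A') \<Longrightarrow>
           card (ecut L X) \<le> 2 * card (ecut L X \<inter> ecut L A')"
    using lexicographic_max_cut[OF graph_edges graph_edges finH finL] HE LE by metis
  have split: "2 \<le> card (ecut H X)" if "attach T c i \<inter> X \<noteq> {}" "attach T c i - X \<noteq> {}" for X i
  proof -
    from that(1) obtain x where "x \<in> attach T c i" by blast
    then have "c x = i" "x \<in> U" by (auto simp: attach_def region_def U_def)
    then have "K i \<subseteq> H" by (auto simp: H_def)
    then have "card (ecut (K i) X) \<le> card (ecut H X)" using finH by (intro card_mono finite_ecut ecut_mono)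
    moreover have "2 \<le> card (ecut (K i) X)" using that by (intro K2) auto
    ultimately show ?thesis by linarith
  qed
  define F where "F = ecut (H \<union> L) A'"
  have FE: "F \<subseteq> E" using HE LE by (auto simp: F_def ecut_def)
  have finF: "finite F" using finH finL by (auto simp: F_def intro: finite_ecut)
  have cardF: "card (ecut F X) = card (ecut H X \<inter> ecut H A') + card (ecut L X \<inter> ecut L A')" for X
  proof -
    have "ecut F X = (ecut H X \<inter> ecut H A') \<union> (ecut L X \<inter> ecut L A')"
      using HL by (auto simp: F_def ecut_def)
    moreover have "(ecut H X \<inter> ecut H A') \<inter> (ecut L X \<inter> ecut L A') = {}"
      using HL by (auto simp: ecut_def)
    ultimately show ?thesis using finH finL by (simp add: card_Un_disjoint finite_ecut)
  qed
  have JHL: "3 \<le> card (ecut H X) + card (ecut L X)" if "X \<inter> T = {}" "X \<inter> U \<noteq> {}" for X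
  proof -
    have "3 \<le> card (ecut J X)" using J3 that by blast
    also have "\<dots> \<le> card (ecut H X \<union> ecut L X)"
      by (intro card_mono finite_UnI finite_ecut finH finL) (auto simp: H_def ecut_def)
    also have "\<dots> \<le> card (ecut H X) + card (ecut L X)" by (rule card_Un_le)
    finally show ?thesis .
  qed
  have F2: "2 \<le> card (ecut F X)" if X: "X \<inter> T = {}" "X \<inter> U \<noteq> {}" for X
  proof (cases "\<exists>i. attach T c i \<inter> X \<noteq> {} \<and> attach T c i - X \<noteq> {}")
    case True
    then have "2 \<le> card (ecut H X)" using split by blast
    \<comment> \<open>More than half of at least two \<open>H\<close>-edges is already two. Exactly
      half brings in the bound for \<open>L\<close>, and half of at least three edges in total,
      rounded up, is two.\<close>
    then show ?thesis using h[OF X(1)] l[OF X(1)] JHL[OF X] unfolding cardF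
      by (cases "card (ecut H X) = 2 * card (ecut H X \<inter> ecut H A')") linarith+
  next
    case False
    \<comment> \<open>\<open>X'\<close> has the same light edges as \<open>X\<close>, but splits no region.\<close>
    define X' where "X' = {v \<in> V - T. attach T c (c v) \<subseteq> X \<and> attach T c (c v) \<noteq> {}}"
    have XU: "v \<in> X' \<longleftrightarrow> v \<in> X" if "v \<in> U" for v
    proof (cases "v \<in> T")
      case True then show ?thesis using X by (auto simp: X'_def)
    next
      case v: False
      then have "v \<in> attach T c (c v)" using that UV by (auto simp: attach_def region_def U_def)
      then show ?thesis using False v that UV by (auto simp: X'_def)
    qed
    have "ecut L X' = ecut L X" by (rule ecut_cong) (use XU in \<open>auto simp: U_def L_def\<close>)
    moreover have "ecut H X' = {}"
    proof -
      have "e \<notin> ecut H X'" if "e \<in> H" for e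
      proof -
        from Hin[OF that] obtain j where "e \<subseteq> region T c j" by blast
        then have "\<And>v. v \<in> e \<Longrightarrow> v \<in> V - T \<and> c v = j" by (auto simp: region_def)
        then show ?thesis unfolding ecut_def X'_def by auto
      qed
      then show ?thesis using ecut_subset[of H X'] by blast
    qed
    moreover have "X' \<inter> T = {}" by (auto simp: X'_def)
    moreover have "X' \<inter> U \<noteq> {}" using X(2) XU by auto
    \<comment> \<open>\<open>X'\<close> cuts no \<open>H\<close>-edge, so the bound for
      \<open>H\<close> holds with equality and at least half of three or more light edges are
      kept.\<close>
    ultimately show ?thesis using h[of X'] l[of X'] JHL[of X'] unfolding cardF by simp
  qed
  have F1: "ecut (F \<inter> inner T c i) X \<noteq> {}"
    if X: "attach T c i \<inter> X \<noteq> {}" "attach T c i - X \<noteq> {}" for i X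
  proof -
    \<comment> \<open>Restricting to the region keeps \<open>H\<close>-edges of other regions from
      crossing, so the edge kept lies in \<open>inner T c i\<close>.\<close>
    let ?X = "X \<inter> region T c i"
    have "2 \<le> card (ecut H ?X)" using X att(2)[of i] by (intro split[of i]) auto
    moreover have "card (ecut H ?X) \<le> 2 * card (ecut H ?X \<inter> ecut H A')"
      by (rule h) (auto simp: region_def)
    ultimately have "card (ecut H ?X \<inter> ecut H A') \<noteq> 0" by linarith
    then have "ecut H ?X \<inter> ecut H A' \<noteq> {}" by (metis card.empty)
    then obtain e where e: "e \<in> ecut H ?X" "e \<in> ecut H A'" by blast
    obtain j where "e \<subseteq> region T c j" using e Hin by (auto simp: ecut_def)
    moreover from this have "j = i" using e by (auto simp: ecut_def region_def)
    ultimately have "e \<in> ecut (F \<inter> inner T c i) X" using e HE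
      by (auto simp: F_def inner_def ecut_def)
    then show ?thesis by blast
  qed
  \<comment> \<open>\<open>F\<close> handles cuts avoiding \<open>T\<close>, the old bichromatic
    edges handle cuts splitting \<open>T\<close>.\<close>
  define M where "M = F \<union> bichromatic E T A'"
  have ME: "M \<subseteq> ecut E A'" using HE LE by (auto simp: M_def F_def ecut_def bichromatic_def)
  define W where "W = T \<union> U \<union> \<Union>H"
  have finW: "finite W" using T finU finH HE by (auto simp: W_def intro: finite_Union_edges)
  have "\<Union>H \<subseteq> V" using HE edge_subset by blast
  then have WV: "W \<subseteq> V" using T UV unfolding W_def by blast
  have "\<Union>F \<subseteq> W" unfolding F_def W_def U_def L_def[symmetric] using ecut_subset[of "H \<union> L" A'] by blast
  moreover have "\<Union>(bichromatic E T A') \<subseteq> W" by (auto simp: bichromatic_def W_def)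
  ultimately have MW: "{e \<in> M. e \<subseteq> W} = M" unfolding M_def by blast
  have gM: "graph V M" by (rule graph_edges) (use ME ecut_subset[of E A'] in blast)
  have BW: "T \<union> U \<subseteq> W" by (auto simp: W_def)
  obtain T' where T': "T \<union> U \<subseteq> T'" "T' \<subseteq> W"
    and tr: "\<And>Y. \<exists>Y'. Y' \<inter> (T \<union> U) = Y \<inter> (T \<union> U) \<and> ecut M Y' = ecut {e \<in> M. e \<subseteq> T'} Y"
    and small: "\<And>X. X \<inter> (T \<union> U) = {} \<Longrightarrow> X \<inter> T' \<noteq> {} \<Longrightarrow> many 2 (ecut {e \<in> M. e \<subseteq> T'} X)"
    by (rule prune[OF gM finW BW, unfolded MW]) blast
  let ?M = "{e \<in> M. e \<subseteq> T'}"
  have sub: "?M \<subseteq> bichromatic E T' A'" using ME by (auto simp: bichromatic_def)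
  have bic: "bichromatic E T A' = bichromatic E T A"
  proof -
    have "ecut {e \<in> E. e \<subseteq> T} A' = ecut {e \<in> E. e \<subseteq> T} A" by (rule ecut_cong) (use A'T in blast)
    then show ?thesis unfolding bichromatic_def ecut_def by blast
  qed
  have away: "many 2 (ecut ?M X)" if X: "X \<inter> T = {}" "X \<inter> T' \<noteq> {}" for X
  proof (cases "X \<inter> U = {}")
    case True then show ?thesis using X by (intro small) auto
  next
    case False
    \<comment> \<open>Pruning provides a \<open>Y\<close> with the same trace whose crossing edges
      in all of \<open>M\<close> are those of \<open>X\<close> in \<open>?M\<close>; to this
      \<open>Y\<close> the bound \<open>F2\<close> applies.\<close>
    obtain Y where Y: "Y \<inter> (T \<union> U) = X \<inter> (T \<union> U)" "ecut M Y = ecut ?M X" using tr[of X] by auto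
    then have "2 \<le> card (ecut F Y)" by (intro F2) (use False X in blast)+
    then have "many 2 (ecut F Y)" by (simp add: many_def)
    then show ?thesis unfolding Y(2)[symmetric] by (rule many_mono) (auto simp: M_def ecut_def)
  qed
  have f1: "two_cut T' A'" unfolding two_cut_def
  proof (intro allI impI)
    fix X assume X: "X \<inter> T' \<noteq> {}" "T' - X \<noteq> {}"
    \<comment> \<open>Either one of the two sides avoids \<open>T\<close>, or \<open>T\<close>
      itself is split and its unchanged colouring already gives two edges.\<close>
    consider "X \<inter> T = {}" | "(T' - X) \<inter> T = {}" | "X \<inter> T \<noteq> {}" "T - X \<noteq> {}" by blast
    then have "many 2 (ecut ?M X)"
    proof cases
      case 1 then show ?thesis using away X by blast
    next
      case 2
      then have "many 2 (ecut ?M (T' - X))" using away X by blast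
      moreover have "ecut ?M (T' - X) = ecut ?M X" by (auto simp: ecut_def)
      ultimately show ?thesis by simp
    next
      case 3
      then have "many 2 (ecut (bichromatic E T A') X)" using tc bic by (auto simp: two_cut_def)
      then show ?thesis by (rule many_mono) (use T' in \<open>auto simp: M_def ecut_def bichromatic_def\<close>)
    qed
    then show "many 2 (ecut (bichromatic E T' A') X)" by (rule many_mono) (intro ecut_mono sub)
  qed
  have f2: "ecut (bichromatic E T' A' \<inter> inner T c i) X \<noteq> {}"
    if X: "attach T c i \<inter> X \<noteq> {}" "attach T c i - X \<noteq> {}" for i X
  proof -
    obtain Y where Y: "Y \<inter> (T \<union> U) = X \<inter> (T \<union> U)" "ecut M Y = ecut ?M X" using tr[of X] by auto
    have "ecut (F \<inter> inner T c i) Y \<noteq> {}" by (rule F1) (use X Y(1) att(1)[of i] in blast)+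
    then obtain e where e: "e \<in> ecut M Y" "e \<in> inner T c i" by (auto simp: ecut_def M_def)
    then have "e \<in> ecut ?M X" using Y by simp
    then have "e \<in> ecut (bichromatic E T' A' \<inter> inner T c i) X" using e sub by (auto simp: ecut_def)
    then show ?thesis by blast
  qed
  have f3: "finite T'" using T'(2) finW finite_subset by blast
  have f4: "T' \<subseteq> V" "T \<subseteq> T'" "\<Union>(light T c) \<subseteq> T'" using T' WV by (auto simp: U_def)
  show ?thesis by (rule that[OF f3 f4 A'T f1 light f2])
qed

text \<open>Dependent choice iterates \<open>grow\<close> from a single vertex. The partition
  \<open>c\<close> belongs to the transition between two stages, so it is chosen afterwards.\<close>

lemma coherent_colourings:
  obtains T :: "nat \<Rightarrow> 'a set" and A :: "nat \<Rightarrow> 'a set" and c :: "nat \<Rightarrow> 'a \<Rightarrow> nat"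
  where "\<And>n. finite (T n)" "\<And>n. T n \<subseteq> V" "\<And>n. T n \<noteq> {}" "\<And>n. two_cut (T n) (A n)"
    "\<And>n. T n \<subseteq> T (Suc n)" "\<And>n. A (Suc n) \<inter> T n = A n \<inter> T n"
    "\<And>n. \<Union>(light (T n) (c n)) \<subseteq> T (Suc n)" "\<And>n. finite (light (T n) (c n))"
    "\<And>n i X. attach (T n) (c n) i \<inter> X \<noteq> {} \<Longrightarrow> attach (T n) (c n) i - X \<noteq> {} \<Longrightarrow>
       ecut (bichromatic E (T (Suc n)) (A (Suc n)) \<inter> inner (T n) (c n) i) X \<noteq> {}"
proof -
  define P where "P p \<longleftrightarrow> finite (fst p) \<and> fst p \<subseteq> V \<and> fst p \<noteq> {} \<and> two_cut (fst p) (snd p)"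
    for p :: "'a set \<times> 'a set"
  define Q where "Q p q c \<longleftrightarrow> fst p \<subseteq> fst q \<and> snd q \<inter> fst p = snd p \<inter> fst p \<and>
      \<Union>(light (fst p) c) \<subseteq> fst q \<and> finite (light (fst p) c) \<and>
      (\<forall>i X. attach (fst p) c i \<inter> X \<noteq> {} \<longrightarrow> attach (fst p) c i - X \<noteq> {} \<longrightarrow>
       ecut (bichromatic E (fst q) (snd q) \<inter> inner (fst p) c i) X \<noteq> {})"
    for p q :: "'a set \<times> 'a set" and c
  obtain v where "v \<in> V" using infinite by fastforce
  then have "P ({v}, {})" by (auto simp: P_def two_cut_def)
  moreover have "\<exists>q. P q \<and> (\<exists>c. Q p q c)" if p: "P p" for p
  proof -
    obtain T A where TA: "p = (T, A)" by fastforce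
    have T: "finite T" "T \<subseteq> V" "T \<noteq> {}" "two_cut T A" using p by (auto simp: P_def TA)
    obtain T' A' c where T': "finite T'" "T' \<subseteq> V" "T \<subseteq> T'" "\<Union>(light T c) \<subseteq> T'" "A' \<inter> T = A \<inter> T"
      "two_cut T' A'" "finite (light T c)"
      "\<And>i X. attach T c i \<inter> X \<noteq> {} \<Longrightarrow> attach T c i - X \<noteq> {} \<Longrightarrow>
         ecut (bichromatic E T' A' \<inter> inner T c i) X \<noteq> {}"
      by (rule grow[OF T], rule that)
    have "P (T', A')" using T' T by (auto simp: P_def)
    moreover have "Q p (T', A') c" unfolding Q_def TA fst_conv snd_conv using T' by (intro conjI allI impI)
    ultimately show ?thesis by blast
  qed
  ultimately obtain f where f: "\<And>n. P (f n)" "\<And>n. \<exists>c. Q (f n) (f (Suc n)) c"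
    using dependent_nat_choice[of "\<lambda>_. P" "\<lambda>_ p q. \<exists>c. Q p q c"] by metis
  from f(2) obtain c where c: "\<And>n. Q (f n) (f (Suc n)) (c n)" by metis
  show ?thesis
    by (rule that[of "\<lambda>n. fst (f n)" "\<lambda>n. snd (f n)" c])
      (use f(1)[unfolded P_def] c[unfolded Q_def] in metis)+
qed

section \<open>The limit colouring\<close>

text \<open>The colour of a vertex is frozen once it enters some \<open>T n\<close>, so the union of
  the \<open>A n \<inter> T n\<close> agrees with every stage. Any cut of \<open>V\<close> splits
  some \<open>T n\<close>, where \<open>two_cut\<close> gives two edges.\<close>

lemma bipartite_cut:
  obtains B where "\<And>X. X \<inter> V \<noteq> {} \<Longrightarrow> V - X \<noteq> {} \<Longrightarrow> many 2 (ecut (ecut E B) X)"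
    and "\<And>X. finite (ecut (ecut E B) X) \<Longrightarrow> finite (ecut E X)"
proof -
  obtain T A c where T: "\<And>n. finite (T n)" "\<And>n. T n \<subseteq> V" "\<And>n. T n \<noteq> {}" "\<And>n. two_cut (T n) (A n)"
    "\<And>n. T n \<subseteq> T (Suc n)" and A: "\<And>n. A (Suc n) \<inter> T n = A n \<inter> T n"
    and light: "\<And>n. \<Union>(light (T n) (c n)) \<subseteq> T (Suc n)" "\<And>n. finite (light (T n) (c n))"
    and att: "\<And>n i X. attach (T n) (c n) i \<inter> X \<noteq> {} \<Longrightarrow> attach (T n) (c n) i - X \<noteq> {} \<Longrightarrow>
       ecut (bichromatic E (T (Suc n)) (A (Suc n)) \<inter> inner (T n) (c n) i) X \<noteq> {}"
    by (rule coherent_colourings) blast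
  have Tmono: "T m \<subseteq> T n" if "m \<le> n" for m n using lift_Suc_mono_le[of T, OF T(5) that] .
  have Amono: "A n \<inter> T m = A m \<inter> T m" if "m \<le> n" for m n
    using that
  proof (induction rule: dec_induct)
    case (step n)
    have "A (Suc n) \<inter> T m = A (Suc n) \<inter> T n \<inter> T m" using Tmono[OF step(1)] by blast
    also have "\<dots> = A n \<inter> T n \<inter> T m" by (simp add: A)
    also have "\<dots> = A n \<inter> T m" using Tmono[OF step(1)] by blast
    finally show ?case using step by simp
  qed simp
  define B where "B = (\<Union>n. A n \<inter> T n)"
  define F where "F = ecut E B"
  have BT: "B \<inter> T n = A n \<inter> T n" for n
  proof -
    have "x \<in> A m \<and> x \<in> T m \<longleftrightarrow> x \<in> A n \<and> x \<in> T m" if "x \<in> T n" for x m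
      using Amono[of m n] Amono[of n m] that by (cases "m \<le> n") auto
    then show ?thesis by (auto simp: B_def)
  qed
  have bF: "bichromatic E (T n) (A n) \<subseteq> F" for n
  proof -
    have "ecut {e \<in> E. e \<subseteq> T n} (A n) = ecut {e \<in> E. e \<subseteq> T n} B" by (rule ecut_cong) (use BT in blast)
    moreover have "bichromatic E (T n) (A n) = ecut {e \<in> E. e \<subseteq> T n} (A n)"
      by (auto simp: bichromatic_def ecut_def)
    ultimately show ?thesis unfolding F_def by (metis (no_types, lifting) ecut_mono mem_Collect_eq subsetI)
  qed
  have FE: "F \<subseteq> E" unfolding F_def by (rule ecut_subset)
  \<comment> \<open>If the stages missed a vertex, some edge would leave their union by
    \<open>three_cut\<close>. It starts in some \<open>T n\<close>, is light there, and so is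
    absorbed by \<open>T (Suc n)\<close>.\<close>
  have cover: "\<exists>n. v \<in> T n" if "v \<in> V" for v
  proof (rule ccontr)
    assume nT: "\<not> ?thesis"
    let ?X = "\<Union>n. T n"
    have "many 3 (ecut E ?X)"
    proof (rule three_cut)
      show "?X \<inter> V \<noteq> {}" using T(2,3)[of 0] by blast
      show "V - ?X \<noteq> {}" using that nT by blast
    qed
    then have "ecut E ?X \<noteq> {}" by (rule many_nonempty) simp
    then obtain e where "e \<in> ecut E ?X" by auto
    then obtain x y where e: "x \<in> ?X" "y \<notin> ?X" "{x, y} \<in> E" by (rule ecutE[OF graph])
    then obtain n where "x \<in> T n" by blast
    then have "{x, y} \<in> light (T n) (c n)" using e by (auto simp: light_def region_def)
    then have "y \<in> T (Suc n)" using light(1)[of n] by auto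
    then show False using e by blast
  qed
  have cover': "\<exists>n. S \<subseteq> T n" if "finite S" "S \<subseteq> V" for S
    using that
  proof (induction S rule: finite_induct)
    case (insert x S)
    then obtain m where "S \<subseteq> T m" by auto
    moreover obtain n where "x \<in> T n" using cover insert by blast
    ultimately show ?case using Tmono[of m "max m n"] Tmono[of n "max m n"] by (intro exI[of _ "max m n"]) auto
  qed simp
  have two: "many 2 (ecut F X)" if X: "X \<inter> V \<noteq> {}" "V - X \<noteq> {}" for X
  proof -
    obtain x y where xy: "x \<in> X" "y \<notin> X" "x \<in> V" "y \<in> V" using X by blast
    then obtain n where "{x, y} \<subseteq> T n" using cover'[of "{x, y}"] by auto
    then have "many 2 (ecut (bichromatic E (T n) (A n)) X)"
      using T(4)[of n] xy unfolding two_cut_def by (elim allE impE) auto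
    then show ?thesis by (rule many_mono) (intro ecut_mono bF)
  qed
  have "finite (ecut E X)" if fin: "finite (ecut F X)" for X
  proof -
    have sub: "ecut F X \<subseteq> E" using FE ecut_subset[of F X] by blast
    then have "\<Union>(ecut F X) \<subseteq> V" using edge_subset by blast
    \<comment> \<open>At this stage every edge of the \<open>F\<close>-cut has its ends in
      \<open>T n\<close>, so none lies inside a region.\<close>
    then obtain n where n: "\<Union>(ecut F X) \<subseteq> T n"
      using cover'[of "\<Union>(ecut F X)"] finite_Union_edges[OF sub fin] by blast
    let ?R = "region (T n) (c n)" and ?I = "inner (T n) (c n)" and ?A = "attach (T n) (c n)"
    have avoid: "ecut (F \<inter> ?I i) X = {}" for i
    proof -
      have "e \<notin> ecut (F \<inter> ?I i) X" for e
      proof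
        assume e: "e \<in> ecut (F \<inter> ?I i) X"
        then obtain x where "x \<in> e" by (auto simp: ecut_def)
        moreover have "e \<in> ecut F X" using e by (simp add: ecut_def)
        ultimately have "x \<in> T n" using n by blast
        moreover have "e \<subseteq> ?R i" using e by (simp add: ecut_def inner_def)
        ultimately show False using \<open>x \<in> e\<close> by (auto simp: region_def)
      qed
      then show ?thesis by auto
    qed
    \<comment> \<open>Otherwise the part of the region in \<open>Z\<close> would have no
      \<open>F\<close>-edge leaving it: such an edge either stays in the region and crosses
      \<open>Z\<close>, or is light and starts at an attachment vertex in \<open>Z\<close>.\<close>
    have key: "?R i \<inter> Z = {}" if Z: "?A i \<inter> Z = {}" "ecut (F \<inter> ?I i) Z = {}" for i Z
    proof (rule ccontr)
      let ?Y = "?R i \<inter> Z"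
      assume "?Y \<noteq> {}"
      then have "?Y \<inter> V \<noteq> {}" "V - ?Y \<noteq> {}" using T(2,3)[of n] by (auto simp: region_def)
      then have "many 2 (ecut F ?Y)" by (rule two)
      then have "ecut F ?Y \<noteq> {}" by (rule many_nonempty) simp
      then obtain e where "e \<in> ecut F ?Y" by auto
      then obtain x y where xy: "x \<in> ?Y" "y \<notin> ?Y" "{x, y} \<in> F" by (rule ecutE[OF graph_edges[OF FE]])
      show False
      proof (cases "y \<in> ?R i")
        case True
        then have "{x, y} \<in> ecut (F \<inter> ?I i) Z" using xy FE unfolding pair_in_ecut by (auto simp: inner_def)
        then show False using Z by blast
      next
        case False
        then have "{x, y} \<in> light (T n) (c n)" using xy FE by (auto simp: light_def region_def)
        then have "x \<in> ?A i" using xy by (auto simp: attach_def)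
        then show False using Z xy by blast
      qed
    qed
    have "ecut E X \<subseteq> light (T n) (c n)"
    proof
      fix e assume e: "e \<in> ecut E X"
      show "e \<in> light (T n) (c n)"
      proof (rule ccontr)
        assume "e \<notin> light (T n) (c n)"
        then obtain i where i: "e \<subseteq> ?R i" using e by (auto simp: light_def ecut_def)
        \<comment> \<open>If both sides contained attachment vertices, stage \<open>Suc n\<close>
          would supply an \<open>F\<close>-edge of the cut inside the region, against
          \<open>avoid\<close>. Hence \<open>key\<close> applies to \<open>X\<close> or to its
          complement.\<close>
        have "?A i \<inter> X = {} \<or> ?A i - X = {}"
        proof (rule ccontr)
          assume "\<not> ?thesis"
          then have "ecut (bichromatic E (T (Suc n)) (A (Suc n)) \<inter> ?I i) X \<noteq> {}" using att by blast
          moreover have "ecut (bichromatic E (T (Suc n)) (A (Suc n)) \<inter> ?I i) X \<subseteq> ecut (F \<inter> ?I i) X"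
            using bF by (intro ecut_mono) blast
          ultimately show False using avoid by blast
        qed
        moreover have "ecut (F \<inter> ?I i) (- X) = {}" using avoid[of i] by (auto simp: ecut_def)
        ultimately have "?R i \<inter> X = {} \<or> ?R i \<inter> - X = {}"
          using key[of i X] key[of i "- X"] avoid[of i] by (metis Diff_eq)
        then show False using i e by (auto simp: ecut_def)
      qed
    qed
    then show ?thesis using light(2) finite_subset by blast
  qed
  then show ?thesis using that[of B] two unfolding F_def by simp
qed

end


section \<open>Rays and ends\<close>

lemma graph_del_edges: "graph V J \<Longrightarrow> graph V (del_edges J S)"
  by (auto simp: graph_def del_edges_def)

lemma ray_mono: "ray V J r \<Longrightarrow> J \<subseteq> J' \<Longrightarrow> ray V J' r"
  by (auto simp: ray_def)

lemma ray_tail: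
  assumes "ray V J r" "finite S"
  obtains k where "\<And>n. k \<le> n \<Longrightarrow> r n \<notin> S" "\<And>n. k \<le> n \<Longrightarrow> reach (del_edges J S) (r k) (r n)"
proof -
  have "finite (r -` S)" using assms by (intro finite_vimageI) (auto simp: ray_def)
  then obtain k where k: "\<forall>n\<in>r -` S. n < k" using finite_nat_set_iff_bounded by blast
  then have *: "r n \<notin> S" if "k \<le> n" for n using k that by (metis linorder_not_less vimageI)
  have "reach (del_edges J S) (r k) (r n)" if "k \<le> n" for n
    using that
  proof (induction rule: dec_induct)
    case (step n)
    have "{r n, r (Suc n)} \<in> del_edges J S"
      using assms(1) *[of n] *[of "Suc n"] step by (auto simp: del_edges_def ray_def)
    then show ?case using step reach_step by metis
  qed (rule reach_refl)
  with * show ?thesis by (rule that)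
qed

text \<open>Beyond \<open>S\<close> each ray stays in one component, so a single link between late
  vertices suffices; \<open>N\<close> is there to push the link onto both tails.\<close>

lemma equiv_raysI:
  assumes r: "ray V J r" and s: "ray V J s"
    and link: "\<And>S N. S \<subseteq> V \<Longrightarrow> finite S \<Longrightarrow> \<exists>m\<ge>N. \<exists>n\<ge>N. reach (del_edges J S) (r m) (s n)"
  shows "equiv_rays V J r s"
  unfolding equiv_rays_def
proof (intro allI impI)
  fix S assume S: "S \<subseteq> V" "finite S"
  let ?R = "reach (del_edges J S)"
  obtain k where k: "\<And>n. k \<le> n \<Longrightarrow> r n \<notin> S" "\<And>n. k \<le> n \<Longrightarrow> ?R (r k) (r n)"
    by (rule ray_tail[OF r S(2)], rule that)
  obtain l where l: "\<And>n. l \<le> n \<Longrightarrow> s n \<notin> S" "\<And>n. l \<le> n \<Longrightarrow> ?R (s l) (s n)"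
    by (rule ray_tail[OF s S(2)], rule that)
  obtain m n where mn: "max k l \<le> m" "max k l \<le> n" "?R (r m) (s n)" using link[OF S] by blast
  have "?R (r k) (s n)" using k(2)[of m] mn by (auto intro: reach_trans)
  then have kl: "?R (r k) (s l)" using reach_sym[OF l(2)[of n]] mn by (auto intro: reach_trans)
  have V: "\<And>n. r n \<in> V" "\<And>n. s n \<in> V" using r s by (auto simp: ray_def)
  let ?C = "{v \<in> V - S. ?R (r k) v}"
  have "?C \<in> components (V - S) (del_edges J S)" unfolding components_def using V k(1)[of k] by blast
  moreover have "contains_tail ?C r" unfolding contains_tail_def using V k by blast
  moreover have "contains_tail ?C s" unfolding contains_tail_def using V l reach_trans[OF kl] by blast
  ultimately show "\<exists>C\<in>components (V - S) (del_edges J S). contains_tail C r \<and> contains_tail C s" by blast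
qed

lemma equiv_raysD:
  assumes "equiv_rays V J r s" "S \<subseteq> V" "finite S"
  obtains N where "\<And>m n. N \<le> m \<Longrightarrow> N \<le> n \<Longrightarrow> reach (del_edges J S) (r m) (s n)"
proof -
  obtain C where "C \<in> components (V - S) (del_edges J S)" "contains_tail C r" "contains_tail C s"
    using assms by (auto simp: equiv_rays_def)
  then obtain u k l where ukl: "\<forall>n\<ge>k. reach (del_edges J S) u (r n)"
      "\<forall>n\<ge>l. reach (del_edges J S) u (s n)"
    unfolding components_def contains_tail_def by blast
  show ?thesis
    by (rule that[of "max k l"]) (meson ukl reach_sym reach_trans max.boundedE)
qed

section \<open>Faithfulness and two-connectivity\<close>

text \<open>The two cut properties that the limit colouring provides for its bichromatic
  edges.\<close>

locale faithful_cut = three_edge_connected +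
  fixes F :: "'a set set"
  assumes sub: "F \<subseteq> E"
    and two: "\<And>X. X \<inter> V \<noteq> {} \<Longrightarrow> V - X \<noteq> {} \<Longrightarrow> many 2 (ecut F X)"
    and finite_cut: "\<And>X. finite (ecut F X) \<Longrightarrow> finite (ecut E X)"
begin

lemma graph_F: "graph V F"
  by (rule graph_edges[OF sub])

lemma connected: "u \<in> V \<Longrightarrow> v \<in> V \<Longrightarrow> reach F u v"
proof (rule ccontr)
  assume uv: "u \<in> V" "v \<in> V" "\<not> reach F u v"
  let ?X = "{w. \<exists>x\<in>{u}. reach F x w}"
  have "many 2 (ecut F ?X)" using uv reach_refl[of F u] by (intro two) auto
  then show False using cut_reach_empty[OF graph_F, of "{u}"] by (auto simp: many_def)
qed

text \<open>Links in \<open>F\<close> are links in \<open>E\<close>. Conversely, if a finite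
  \<open>S\<close> separates tails in \<open>F\<close>, the component of one tail has a finite
  \<open>F\<close>-cut, hence a finite \<open>E\<close>-cut, and the ends of that cut separate the
  rays in the whole graph.\<close>

lemma equiv_rays_iff:
  assumes r: "ray V F r" and s: "ray V F s"
  shows "equiv_rays V F r s \<longleftrightarrow> equiv_rays V E r s"
proof
  assume eq: "equiv_rays V F r s"
  show "equiv_rays V E r s"
  proof (rule equiv_raysI[OF ray_mono[OF r sub] ray_mono[OF s sub]])
    fix S :: "'a set" and N :: nat assume "S \<subseteq> V" "finite S"
    then obtain M where M: "\<And>m n. M \<le> m \<Longrightarrow> M \<le> n \<Longrightarrow> reach (del_edges F S) (r m) (s n)"
      by (rule equiv_raysD[OF eq]) (rule that)
    have "del_edges F S \<subseteq> del_edges E S" using sub by (auto simp: del_edges_def)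
    then have "reach (del_edges E S) (r (max M N)) (s (max M N))"
      using reach_mono[OF M[of "max M N" "max M N"]] by simp
    then show "\<exists>m\<ge>N. \<exists>n\<ge>N. reach (del_edges E S) (r m) (s n)" by (meson max.cobounded2)
  qed
next
  assume eq: "equiv_rays V E r s"
  show "equiv_rays V F r s"
  proof (rule equiv_raysI[OF r s], rule ccontr)
    fix S :: "'a set" and N :: nat
    assume S: "S \<subseteq> V" "finite S"
      and no: "\<not> (\<exists>m\<ge>N. \<exists>n\<ge>N. reach (del_edges F S) (r m) (s n))"
    let ?D = "del_edges F S"
    obtain k where k: "\<And>n. k \<le> n \<Longrightarrow> reach ?D (r k) (r n)"
      by (rule ray_tail[OF r S(2)], rule that)
    let ?X = "{v. \<exists>u\<in>{r k}. reach ?D u v}"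
    have "ecut ?D ?X = {}" by (rule cut_reach_empty[OF graph_del_edges[OF graph_F]])
    \<comment> \<open>No edge of \<open>F\<close> avoiding \<open>S\<close> leaves
      \<open>?X\<close>, and only finitely many edges meet \<open>S\<close>.\<close>
    then have "ecut F ?X \<subseteq> {e \<in> E. e \<inter> S \<noteq> {}}" using sub unfolding ecut_def del_edges_def by auto
    then have "finite (ecut F ?X)" using finite_edges_meeting[OF S(2)] finite_subset by blast
    then have fin: "finite (ecut E ?X)" by (rule finite_cut)
    let ?S = "\<Union>(ecut E ?X)"
    have "?S \<subseteq> V" using edge_subset ecut_subset[of E ?X] by blast
    moreover have "finite ?S" using ecut_subset[of E ?X] fin by (rule finite_Union_edges)
    ultimately obtain M where M: "\<And>m n. M \<le> m \<Longrightarrow> M \<le> n \<Longrightarrow> reach (del_edges E ?S) (r m) (s n)"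
      by (rule equiv_raysD[OF eq]) (rule that)
    \<comment> \<open>Late enough for \<open>r m\<close> to lie in \<open>?X\<close>, for
      \<open>no\<close> to apply, and for \<open>M\<close> to link the rays outside
      \<open>?S\<close>.\<close>
    define m where "m = max (max k N) M"
    have "r m \<in> ?X" using k[of m] by (simp add: m_def)
    moreover have "s m \<notin> ?X"
    proof
      assume "s m \<in> ?X"
      then have "reach ?D (r m) (s m)" using reach_trans[OF reach_sym[OF k[of m]]] by (simp add: m_def)
      moreover have "N \<le> m" by (simp add: m_def)
      ultimately show False using no by blast
    qed
    moreover have "reach (del_edges E ?S) (r m) (s m)" by (rule M) (simp_all add: m_def)
    ultimately have "ecut (del_edges E ?S) ?X \<noteq> {}" by (intro reach_cut)
    then obtain e where e: "e \<in> ecut (del_edges E ?S) ?X" by auto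
    then have "e \<in> ecut E ?X" "e \<inter> ?S = {}" by (simp_all add: ecut_def del_edges_def)
    moreover have "e \<noteq> {}" using e by (auto simp: ecut_def)
    ultimately show False by blast
  qed
qed

text \<open>Koenig's lemma in the breadth-first layering of \<open>F\<close>: \<open>s\<close> climbs one layer at a time and
  stays below infinitely many vertices of \<open>r\<close>, so from high up on \<open>s\<close> one can climb on to \<open>r\<close> without
  meeting a given finite set.\<close>

lemma ray_towards:
  assumes r: "ray V E r"
  obtains s where "ray V F s" "equiv_rays V E r s"
proof -
  have rV: "r n \<in> V" for n using r by (simp add: ray_def)
  have injr: "inj r" using r by (simp add: ray_def)
  define R where "R = (\<lambda>u v. {u, v} \<in> F)"
  define d where "d v = (LEAST n. (R ^^ n) (r 0) v)" for v
  define up where "up a b \<longleftrightarrow> {a, b} \<in> F \<and> d b = Suc (d a)" for a b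
  have dist: "(R ^^ d v) (r 0) v" if "v \<in> V" for v
  proof -
    have "R\<^sup>*\<^sup>* (r 0) v" using connected[OF rV that] by (simp add: reach_def R_def)
    then obtain n where "(R ^^ n) (r 0) v" using rtranclp_imp_relpowp by metis
    then show ?thesis unfolding d_def by (rule LeastI)
  qed
  have dist_le: "d v \<le> n" if "(R ^^ n) (r 0) v" for v n unfolding d_def using that by (rule Least_le)
  have upV: "y \<in> V" if "up x y" for x y using that sub edge_subset by (auto simp: up_def)
  have from_root: "up\<^sup>*\<^sup>* (r 0) v" if "v \<in> V" for v
    using that
  proof (induction "d v" arbitrary: v)
    case 0
    then show ?case using dist[of v] by auto
  next
    case (Suc n)
    then have "(R ^^ Suc n) (r 0) v" using dist[of v] by simp
    then obtain u where u: "(R ^^ n) (r 0) u" "R u v" by (rule relpowp_Suc_E)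
    then have uV: "u \<in> V" using sub edge_subset by (auto simp: R_def)
    have "(R ^^ Suc (d u)) (r 0) v" using dist[OF uV] u(2) by (rule relpowp_Suc_I)
    then have "d v \<le> Suc (d u)" by (rule dist_le)
    then have "d u = n" using Suc(2) dist_le[OF u(1)] by simp
    then have "up u v" using u(2) Suc(2) by (simp add: up_def R_def)
    then show ?case using Suc(1)[of u] \<open>d u = n\<close> uV by (metis rtranclp.rtrancl_into_rtrancl)
  qed
  have fin_up: "finite {y. up x y}" for x
  proof -
    have "finite (\<Union>{e \<in> E. x \<in> e})" using locally_finite by (intro finite_Union_edges) auto
    then show ?thesis by (rule finite_subset[rotated]) (use sub in \<open>auto simp: up_def\<close>)
  qed
  \<comment> \<open>The invariant of Koenig's argument: infinitely many vertices of \<open>r\<close>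
    can be reached by climbing from \<open>x\<close>.\<close>
  define G where "G x \<longleftrightarrow> x \<in> V \<and> infinite {k. up\<^sup>*\<^sup>* x (r k)}" for x
  have "G (r 0)" using from_root rV by (simp add: G_def)
  moreover have "\<exists>y. G y \<and> up x y" if "G x" for x
  proof (rule ccontr)
    assume no: "\<not> ?thesis"
    then have "finite {k. up\<^sup>*\<^sup>* y (r k)}" if "up x y" for y using that upV by (auto simp: G_def)
    then have "finite (\<Union>y\<in>{y. up x y}. {k. up\<^sup>*\<^sup>* y (r k)})" using fin_up by blast
    \<comment> \<open>The climb to \<open>r k\<close> may have length zero; by injectivity this
      concerns only finitely many \<open>k\<close>.\<close>
    moreover have "finite (r -` {x})" using injr by (intro finite_vimageI) auto
    moreover have "{k. up\<^sup>*\<^sup>* x (r k)} \<subseteq> (\<Union>y\<in>{y. up x y}. {k. up\<^sup>*\<^sup>* y (r k)}) \<union> r -` {x}"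
      by (auto elim: converse_rtranclpE)
    ultimately have "finite {k. up\<^sup>*\<^sup>* x (r k)}" by (meson finite_UnI finite_subset)
    then show False using that by (simp add: G_def)
  qed
  ultimately obtain s where s: "\<And>n. G (s n)" "\<And>n. up (s n) (s (Suc n))"
    using dependent_nat_choice[of "\<lambda>_. G" "\<lambda>_. up"] by metis
  have ds: "d (s n) = d (s 0) + n" for n using s(2) by (induction n) (auto simp: up_def)
  have "inj s" by (rule injI) (metis ds add_left_cancel)
  then have rayF: "ray V F s" using s by (auto simp: ray_def G_def up_def)
  \<comment> \<open>Climbing never returns to a lower layer, so a set lying entirely below
    \<open>x\<close> is not met.\<close>
  have avoid: "reach (del_edges F S) x y \<and> d x \<le> d y" if "up\<^sup>*\<^sup>* x y" "\<forall>v\<in>S. d v < d x" for S x y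
    using that(1)
  proof (induction rule: rtranclp_induct)
    case (step y z)
    then have "d z = Suc (d y)" "{y, z} \<in> F" by (auto simp: up_def)
    moreover from this have "{y, z} \<in> del_edges F S" using that(2) step by (auto simp: del_edges_def)
    ultimately show ?case using step by (auto intro: reach_step)
  qed (simp add: reach_refl)
  have "equiv_rays V E r s"
  proof (rule equiv_raysI[OF r ray_mono[OF rayF sub]])
    fix S :: "'a set" and N :: nat assume "S \<subseteq> V" "finite S"
    then obtain M where M: "\<forall>v\<in>S. d v < M" using finite_nat_set_iff_bounded[of "d ` S"] by auto
    let ?n = "max M N"
    have "infinite {k. up\<^sup>*\<^sup>* (s ?n) (r k)}" using s(1) by (simp add: G_def)
    then obtain m where m: "N \<le> m" "up\<^sup>*\<^sup>* (s ?n) (r m)" unfolding finite_nat_set_iff_bounded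
      by (metis (mono_tags, lifting) mem_Collect_eq not_less)
    have "\<forall>v\<in>S. d v < d (s ?n)" using M ds[of ?n] by force
    then have "reach (del_edges F S) (r m) (s ?n)" using avoid[OF m(2)] reach_sym by metis
    then have "reach (del_edges E S) (r m) (s ?n)"
      by (rule reach_mono) (use sub in \<open>auto simp: del_edges_def\<close>)
    then show "\<exists>m\<ge>N. \<exists>n\<ge>N. reach (del_edges E S) (r m) (s n)" using m(1) by (meson max.cobounded2)
  qed
  with rayF show ?thesis by (rule that)
qed

lemma faithful: "faithful V F V E"
proof -
  have "\<exists>s\<in>\<omega>. ray V F s" if "\<omega> \<in> ends V E" for \<omega>
  proof -
    from that obtain r where r: "ray V E r" "\<omega> = {s. ray V E s \<and> equiv_rays V E r s}"
      unfolding ends_def by blast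
    obtain s where "ray V F s" "equiv_rays V E r s" by (rule ray_towards[OF r(1)])
    then show ?thesis using r(2) ray_mono[OF _ sub] by blast
  qed
  then show ?thesis using sub graph_F equiv_rays_iff by (auto simp: faithful_def subgraph_def)
qed

text \<open>If \<open>a\<close> were a cut vertex, both sides would send at least two edges to \<open>a\<close>.\<close>

lemma two_connected:
  assumes "cubic V E"
  shows "k_connected 2 V F"
  unfolding k_connected_def
proof (intro conjI allI impI)
  show "infinite V \<or> 2 < card V" using infinite by simp
  fix S assume S: "S \<subseteq> V" "finite S" "card S < 2"
  have "reach (del_edges F S) u v" if uv: "u \<in> V - S" "v \<in> V - S" for u v
  proof (cases "S = {}")
    case True
    then show ?thesis using connected uv by (simp add: del_edges_def)
  next
    case False
    then have "card S = 1" using S by (metis One_nat_def card_0_eq less_2_cases)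
    then obtain a where a: "S = {a}" by (metis card_1_singletonE)
    show ?thesis
    proof (rule ccontr)
      assume no: "\<not> ?thesis"
      let ?Z = "{w. \<exists>x\<in>{u}. reach (del_edges F S) x w}"
      let ?X = "?Z - {a}" and ?Y = "V - ?Z - {a}"
      have empty: "ecut (del_edges F S) ?Z = {}" by (rule cut_reach_empty[OF graph_del_edges[OF graph_F]])
      have at: "a \<in> e" if "e \<in> ecut F ?X \<or> e \<in> ecut F ?Y" for e
      proof (rule ccontr)
        assume "a \<notin> e"
        have "e \<in> F" using that by (auto simp: ecut_def)
        then have "e \<subseteq> V" using sub edge_subset by blast
        then have "e \<in> ecut F ?Z" using that \<open>a \<notin> e\<close> unfolding ecut_def by blast
        then have "e \<in> ecut (del_edges F S) ?Z" using \<open>a \<notin> e\<close> a by (simp add: ecut_def del_edges_def)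
        then show False using empty by blast
      qed
      have star: "finite {e \<in> E. a \<in> e}" "card {e \<in> E. a \<in> e} = 3"
        using assms S a by (auto simp: cubic_def)
      have sX: "ecut F ?X \<subseteq> {e \<in> E. a \<in> e}" and sY: "ecut F ?Y \<subseteq> {e \<in> E. a \<in> e}"
        using at sub ecut_subset[of F ?X] ecut_subset[of F ?Y] by blast+
      have "many 2 (ecut F ?X)" using uv a S reach_refl[of _ u] by (intro two) auto
      then have X2: "2 \<le> card (ecut F ?X)" using finite_subset[OF sX star(1)] by (simp add: many_def)
      have "many 2 (ecut F ?Y)" using uv a S no by (intro two) auto
      then have Y2: "2 \<le> card (ecut F ?Y)" using finite_subset[OF sY star(1)] by (simp add: many_def)
      \<comment> \<open>A common edge would contain \<open>a\<close> and a vertex of each side,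
        three vertices in all. So the two cuts are disjoint subsets of the three edges at
        \<open>a\<close>.\<close>
      have "ecut F ?X \<inter> ecut F ?Y = {}"
      proof (rule ccontr)
        assume "\<not> ?thesis"
        then obtain e where e: "e \<in> ecut F ?X" "e \<in> ecut F ?Y" by auto
        then obtain x y where "x \<in> e" "x \<in> ?X" "y \<in> e" "y \<in> ?Y" unfolding ecut_def by auto
        moreover have "a \<in> e" using at e by blast
        moreover have "x \<noteq> y" "x \<noteq> a" "y \<noteq> a" using calculation by auto
        moreover obtain p q where "e = {p, q}" by (rule ecutE[OF graph_F e(1)])
        ultimately show False by auto
      qed
      then have "card (ecut F ?X) + card (ecut F ?Y) = card (ecut F ?X \<union> ecut F ?Y)"
        using sX sY star(1) by (intro card_Un_disjoint[symmetric]) (auto intro: finite_subset)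
      also have "\<dots> \<le> 3" using card_mono[OF star(1), of "ecut F ?X \<union> ecut F ?Y"] sX sY star(2) by simp
      finally show False using X2 Y2 by simp
    qed
  qed
  moreover have "V - S \<noteq> {}" using infinite S by (metis Diff_eq_empty_iff finite_subset)
  ultimately show "connected_graph (V - S) (del_edges F S)" by (simp add: connected_graph_def)
qed

end

section \<open>From vertex connectivity to edge cuts, and the conclusion\<close>

text \<open>Deleting one end of each edge of a small cut would disconnect the graph. The ends are
  taken on an infinite side, so that vertices remain on both sides; one of the two sides is infinite
  because \<open>V\<close> is.\<close>

lemma cut_many_of_3_connected:
  assumes "graph V E" "infinite V" "k_connected 3 V E" and X: "X \<inter> V \<noteq> {}" "V - X \<noteq> {}"
  shows "many 3 (ecut E X)"
proof -
  have *: "many 3 (ecut E X)" if X: "X \<inter> V \<noteq> {}" and inf: "infinite (V - X)" for X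
  proof (rule ccontr)
    assume "\<not> ?thesis"
    then have few: "finite (ecut E X)" "card (ecut E X) < 3" by (auto simp: many_def)
    have "\<exists>v. v \<in> e \<inter> V - X" if "e \<in> ecut E X" for e
      by (rule ecutE[OF assms(1) that]) auto
    then obtain f where f: "\<And>e. e \<in> ecut E X \<Longrightarrow> f e \<in> e \<inter> V - X" by metis
    let ?S = "f ` ecut E X"
    have S: "?S \<subseteq> V" "finite ?S" "card ?S < 3" using f few card_image_le[OF few(1), of f] by auto
    then have con: "connected_graph (V - ?S) (del_edges E ?S)" using assms(3) unfolding k_connected_def by blast
    obtain x where "x \<in> X" "x \<in> V" using X by blast
    moreover have "infinite (V - X - ?S)" using inf S(2) by simp
    then obtain y where y: "y \<in> V - X - ?S" by (metis finite.emptyI ex_in_conv)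
    moreover have "x \<notin> ?S" using f \<open>x \<in> X\<close> by blast
    ultimately have "reach (del_edges E ?S) x y" using con unfolding connected_graph_def by blast
    then have "ecut (del_edges E ?S) X \<noteq> {}" using \<open>x \<in> X\<close> y by (intro reach_cut) auto
    then obtain e where "e \<in> ecut (del_edges E ?S) X" by auto
    then have "e \<in> ecut E X" "e \<inter> ?S = {}" by (auto simp: ecut_def del_edges_def)
    then show False using f[of e] by blast
  qed
  show ?thesis
  proof (cases "finite (V - X)")
    case False
    then show ?thesis using * X by blast
  next
    case True
    then have "infinite (V - (V - X))" using assms(2) by (metis Diff_infinite_finite)
    then have "many 3 (ecut E (V - X))" using X(2) by (intro *) auto
    moreover have "ecut E (V - X) \<subseteq> ecut E X"
    proof
      fix e assume "e \<in> ecut E (V - X)"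
      then show "e \<in> ecut E X" using assms(1) by (elim ecutE[rotated]) (auto simp: ecut_def)
    qed
    ultimately show ?thesis by (rule many_mono)
  qed
qed

theorem theorem6:
  fixes V :: "'a set" and E :: "'a set set"
  assumes "graph V E" and "infinite V" and "k_connected 3 V E" and "cubic V E"
  shows "\<exists>EF. spanning_subgraph V EF V E \<and> k_connected 2 V EF \<and> bipartite V EF
             \<and> faithful V EF V E"
proof -
  interpret three_edge_connected V E
  proof
    show "finite {e \<in> E. v \<in> e}" for v
    proof (cases "v \<in> V")
      case True
      then show ?thesis using assms(4) by (simp add: cubic_def)
    next
      case False
      then have "{e \<in> E. v \<in> e} = {}" using assms(1) by (auto simp: graph_def)
      then show ?thesis by (simp only: finite.emptyI)
    qed
  qed (use assms cut_many_of_3_connected in auto)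
  obtain B where B: "\<And>X. X \<inter> V \<noteq> {} \<Longrightarrow> V - X \<noteq> {} \<Longrightarrow> many 2 (ecut (ecut E B) X)"
    "\<And>X. finite (ecut (ecut E B) X) \<Longrightarrow> finite (ecut E X)"
    by (rule bipartite_cut, rule that)
  let ?F = "ecut E B"
  interpret faithful_cut V E ?F
    by unfold_locales (use B in \<open>simp_all add: ecut_subset\<close>)
  have "bipartite V ?F"
    unfolding bipartite_def
  proof (intro exI conjI ballI)
    \<comment> \<open>\<open>bipartite_cut\<close> does not assert that \<open>B\<close> lies in
      \<open>V\<close>, hence the intersection.\<close>
    show "B \<inter> V \<union> (V - B) = V" "B \<inter> V \<inter> (V - B) = {}" by auto
    fix e assume "e \<in> ?F"
    then obtain x y where "e = {x, y}" "x \<in> B" "y \<notin> B" "x \<in> V" "y \<in> V" by (rule ecutE[OF graph])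
    then have "e \<inter> (B \<inter> V) = {x}" "e \<inter> (V - B) = {y}" by auto
    then show "card (e \<inter> (B \<inter> V)) = 1" "card (e \<inter> (V - B)) = 1" by simp_all
  qed
  moreover have "spanning_subgraph V ?F V E"
    using graph_F sub by (simp add: spanning_subgraph_def subgraph_def)
  ultimately show ?thesis using two_connected[OF assms(4)] faithful by blast
qed

end
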